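(* Let $G$ be a $C_{4k}$-free bipartite graph and let $v\in V(G)$. Then $v\in \operatorname{Supp}(G)$ if and only if there exists a maximum matching $M$ of $G$ such that $v$ is not saturated by $M$ (i.e. $v$ lies in no edge of $M$).
   Context: All graphs are finite, simple and undirected. A graph is a $C_{4k}$-free bipartite graph if it is bipartite and contains no cycle whose length is a multiple of $4$. For a graph $G$, $A(G)$ is its adjacency matrix and $\operatorname{Null}(G)=\{\vec{x}\in\mathbb{R}^{V(G)} : A(G)\vec{x}=0\}$. The support $\operatorname{Supp}(G)$ is the set of vertices $v$ such that $\vec{x}_v\neq 0$ for some $\vec{x}\in\operatorname{Null}(G)$. *)

theory Defs
  imports "HOL-Analysis.Analysis"
begin

text \<open>
  A finite graph is given by its edge set \<open>E\<close>, a set of two-element subsets of a finite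
  type \<open>'v\<close>; its vertex set \<open>V(G)\<close> is all of \<open>'v\<close>, so isolated vertices are allowed.
\<close>

definition simple_graph :: "'v::finite set set \<Rightarrow> bool" where
  "simple_graph E \<longleftrightarrow> (\<forall>e\<in>E. card e = 2)"

definition bipartite :: "'v::finite set set \<Rightarrow> bool" where
  "bipartite E \<longleftrightarrow>
     (\<exists>X Y. X \<union> Y = UNIV \<and> X \<inter> Y = {} \<and> (\<forall>e\<in>E. \<exists>x\<in>X. \<exists>y\<in>Y. e = {x, y}))"

text \<open>
  A cycle is listed by its vertices in cyclic order, without repeating the first vertex at
  the end; hence its length (number of edges) is the length of the list.
\<close>

definition is_cycle :: "'v::finite set set \<Rightarrow> 'v list \<Rightarrow> bool" where
  "is_cycle E c \<longleftrightarrow> 3 \<le> length c \<and> distinct c \<and>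
     (\<forall>i<length c. {c ! i, c ! (Suc i mod length c)} \<in> E)"

definition C4k_free_bipartite :: "'v::finite set set \<Rightarrow> bool" where
  "C4k_free_bipartite E \<longleftrightarrow>
     simple_graph E \<and> bipartite E \<and> \<not> (\<exists>c. is_cycle E c \<and> 4 dvd length c)"

definition adjacency_matrix :: "'v::finite set set \<Rightarrow> real ^ 'v ^ 'v" where
  "adjacency_matrix E = (\<chi> u w. if {u, w} \<in> E then 1 else 0)"

definition Null :: "'v::finite set set \<Rightarrow> (real ^ 'v) set" where
  "Null E = {x. adjacency_matrix E *v x = 0}"

definition Supp :: "'v::finite set set \<Rightarrow> 'v set" where
  "Supp E = {v. \<exists>x\<in>Null E. x $ v \<noteq> 0}"

definition matching :: "'v::finite set set \<Rightarrow> 'v set set \<Rightarrow> bool" where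
  "matching E M \<longleftrightarrow> M \<subseteq> E \<and> (\<forall>e\<in>M. \<forall>f\<in>M. e \<noteq> f \<longrightarrow> e \<inter> f = {})"

definition maximum_matching :: "'v::finite set set \<Rightarrow> 'v set set \<Rightarrow> bool" where
  "maximum_matching E M \<longleftrightarrow> matching E M \<and> (\<forall>M'. matching E M' \<longrightarrow> card M' \<le> card M)"

definition saturated :: "'v::finite set set \<Rightarrow> 'v \<Rightarrow> bool" where
  "saturated M v \<longleftrightarrow> (\<exists>e\<in>M. v \<in> e)"

end

theory Submission
  imports Defs
begin

text \<open>
  Fix a maximum matching \<open>M\<close> and a null vector \<open>x\<close>. If \<open>x\<close> is nonzero at \<open>a\<close> and \<open>{a, y} \<in> M\<close>,
  then the equation at \<open>y\<close> yields a neighbour \<open>b\<close> of \<open>y\<close> at which \<open>x\<close> has the opposite sign.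
  Iterating gives an \<open>M\<close>-alternating walk. If it revisited a vertex, the signs would force an
  even number of such double steps, that is, a cycle of length divisible by 4; so the walk reaches
  an unsaturated vertex, and exchanging \<open>M\<close> along it frees \<open>a\<close>.

  Conversely, let \<open>M\<close> miss \<open>v\<close> and let \<open>R\<close> be the set of vertices from which \<open>v\<close> can be reached in
  this way. By maximality every neighbour of \<open>R\<close> is matched into \<open>R - {v}\<close>, so the null vectors
  supported on \<open>R\<close> are the solutions of a system with fewer equations than unknowns. A nonzero solution
  is nonzero at some unsaturated vertex of \<open>R\<close>, by the walk above, and this can only be \<open>v\<close>.
\<close>

section \<open>Alternating double steps and paths\<close>

definition alt_step :: "'v::finite set set \<Rightarrow> 'v set set \<Rightarrow> 'v \<Rightarrow> 'v \<Rightarrow> bool" where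
  "alt_step E M a b \<longleftrightarrow> (\<exists>y. {a, y} \<in> M \<and> {y, b} \<in> E)"

text \<open>Only every second vertex is listed: the partner between two entries is determined by the
  matching. Distinctness is imposed here because \<open>alt_step\<close> alone permits
  \<open>b = a\<close>.\<close>

fun alt_path :: "'v::finite set set \<Rightarrow> 'v set set \<Rightarrow> 'v list \<Rightarrow> bool" where
  "alt_path E M [] \<longleftrightarrow> False"
| "alt_path E M [b] \<longleftrightarrow> \<not> saturated M b"
| "alt_path E M (a # b # p) \<longleftrightarrow> alt_step E M a b \<and> a \<notin> set (b # p) \<and> alt_path E M (b # p)"

lemma alt_path_suffix: "alt_path E M (p @ q) \<Longrightarrow> q \<noteq> [] \<Longrightarrow> alt_path E M q"
proof (induction p)
  case (Cons a p)
  then show ?case by (cases "p @ q") auto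
qed simp

text \<open>Double steps are prepended one at a time. If the new vertex already occurs, the suffix
  starting at it is taken instead, which cuts out the loop.\<close>

lemma alt_path_from_reachable:
  assumes "(alt_step E M)\<^sup>*\<^sup>* a b" and "\<not> saturated M b"
  shows "\<exists>p. alt_path E M (a # p)"
  using assms(1)
proof (induction rule: converse_rtranclp_induct)
  case base
  then show ?case using assms(2) by (intro exI[of _ "[]"]) simp
next
  case (step a c)
  then obtain p where p: "alt_path E M (c # p)" by blast
  show ?case
  proof (cases "a \<in> set (c # p)")
    case True
    then obtain q r where "c # p = q @ a # r" by (meson split_list)
    then show ?thesis using alt_path_suffix p by (metis list.distinct(1))
  next
    case False
    then show ?thesis using p step(1) by (intro exI[of _ "c # p"]) simp
  qed
qed

section \<open>Basic facts on matchings and null vectors\<close>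

lemma matching_partner_unique:
  assumes "matching E M" "{a, y} \<in> M" "{b, y} \<in> M"
  shows "a = b"
proof -
  have "{a, y} = {b, y}"
    using assms unfolding matching_def by (metis IntI empty_iff insert_iff)
  then show ?thesis by (auto simp: doubleton_eq_iff)
qed

lemma maximum_matching_exists: "\<exists>M. maximum_matching E M"
proof -
  have "finite {M. matching E M}" by simp
  moreover have "{} \<in> {M. matching E M}" by (simp add: matching_def)
  ultimately obtain M where "matching E M" "\<And>M'. matching E M' \<Longrightarrow> card M' \<le> card M"
    using Max_in[of "card ` {M. matching E M}"] Max_ge[of "card ` {M. matching E M}"]
    by (smt (verit) empty_iff finite_imageI image_iff mem_Collect_eq)
  then show ?thesis unfolding maximum_matching_def by blast
qed

lemma Null_iff: "x \<in> Null E \<longleftrightarrow> (\<forall>y. (\<Sum>w | {y, w} \<in> E. x $ w) = 0)"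
proof -
  have "(adjacency_matrix E *v x) $ y = (\<Sum>w | {y, w} \<in> E. x $ w)" for y
    by (simp add: adjacency_matrix_def matrix_vector_mult_def if_distrib[of "\<lambda>c. c * _"]
        sum.If_cases cong: if_cong)
  then show ?thesis by (simp add: Null_def vec_eq_iff)
qed

text \<open>Only one side is fixed: double steps from \<open>X\<close> stay in \<open>X\<close>, and
  the partners in between lie outside.\<close>

locale bipartite_graph =
  fixes E :: "'v::finite set set" and X :: "'v set"
  assumes simple: "simple_graph E"
    and crossing: "{u, w} \<in> E \<Longrightarrow> u \<in> X \<longleftrightarrow> w \<notin> X"
begin

lemma saturatedE:
  assumes "M \<subseteq> E" "saturated M u"
  obtains w where "{u, w} \<in> M"
proof -
  obtain e where e: "e \<in> M" "u \<in> e" using assms(2) unfolding saturated_def by blast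
  then have "card e = 2" using assms(1) simple unfolding simple_graph_def by blast
  then show thesis using e that by (auto simp: card_2_iff insert_commute)
qed

lemma alt_step_side: "M \<subseteq> E \<Longrightarrow> alt_step E M a b \<Longrightarrow> a \<in> X \<Longrightarrow> b \<in> X"
  unfolding alt_step_def using crossing by blast

lemma reachable_side:
  assumes "(alt_step E M)\<^sup>*\<^sup>* a b" "M \<subseteq> E" "a \<in> X"
  shows "b \<in> X"
  using assms(1) by induction (use assms alt_step_side in blast)+

lemma alt_path_side:
  "alt_path E M (a # p) \<Longrightarrow> M \<subseteq> E \<Longrightarrow> a \<in> X \<Longrightarrow> set (a # p) \<subseteq> X"
proof (induction p arbitrary: a)
  case (Cons b p)
  then have "b \<in> X" using alt_step_side by auto
  then show ?case using Cons by auto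
qed simp

section \<open>Exchange along alternating paths\<close>

lemma maximum_matching_swap:
  assumes M: "maximum_matching E M" and b: "\<not> saturated M b"
    and by_E: "{y, b} \<in> E" and ay: "{a, y} \<in> M"
  defines "M' \<equiv> insert {y, b} (M - {{a, y}})"
  shows "maximum_matching E M'" and "\<not> saturated M' a"
proof -
  have mat: "matching E M" using M by (simp add: maximum_matching_def)
  have disj: "e \<inter> {a, y} = {}" if "e \<in> M" "e \<noteq> {a, y}" for e
    using mat that ay by (simp add: matching_def)
  have bn: "b \<notin> e" if "e \<in> M" for e using b that unfolding saturated_def by blast
  have "matching E M'"
    unfolding matching_def M'_def
  proof (intro conjI ballI impI)
    show "insert {y, b} (M - {{a, y}}) \<subseteq> E" using mat by_E unfolding matching_def by blast
    fix e f
    assume "e \<in> insert {y, b} (M - {{a, y}})" "f \<in> insert {y, b} (M - {{a, y}})" "e \<noteq> f"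
    then show "e \<inter> f = {}"
      using disj bn mat unfolding matching_def by (auto 4 3)
  qed
  moreover have "card M' = card M"
  proof -
    have "{y, b} \<notin> M" using bn by blast
    then have "card M' = Suc (card (M - {{a, y}}))" unfolding M'_def by simp
    also have "\<dots> = card M" by (rule card_Suc_Diff1[OF finite ay])
    finally show ?thesis .
  qed
  ultimately show "maximum_matching E M'" using M by (simp add: maximum_matching_def)
  have "a \<noteq> b" using bn ay by blast
  moreover have "a \<noteq> y" using crossing ay mat unfolding matching_def by blast
  ultimately show "\<not> saturated M' a" using disj unfolding saturated_def M'_def by blast
qed

text \<open>The exchange runs from the unsaturated end: the tail first frees \<open>b\<close>, then
  \<open>{a, y}\<close> is traded for \<open>{y, b}\<close>. The clause on edges missing the path
  keeps \<open>{a, y}\<close> available for this trade; the clause on vertices outside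
  \<open>X\<close> serves \<open>matched_neighbour\<close>.\<close>

lemma exchange_along_path:
  assumes M: "maximum_matching E M"
  shows "alt_path E M (a # p) \<Longrightarrow> a \<in> X \<Longrightarrow>
    \<exists>M'. maximum_matching E M' \<and> \<not> saturated M' a \<and>
         (\<forall>e\<in>M. e \<inter> set (a # p) = {} \<longrightarrow> e \<in> M') \<and>
         (\<forall>y. y \<notin> X \<longrightarrow> saturated M' y \<longrightarrow> saturated M y)"
proof (induction p arbitrary: a)
  case Nil
  then show ?case using M by auto
next
  case (Cons b p)
  have sub: "M \<subseteq> E" using M by (simp add: maximum_matching_def matching_def)
  obtain y where y: "{a, y} \<in> M" "{y, b} \<in> E"
    using Cons.prems by (auto simp: alt_step_def)
  have side: "set (a # b # p) \<subseteq> X" using alt_path_side Cons.prems sub by blast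
  have "y \<notin> X" using crossing y sub Cons.prems by blast
  have "b \<in> X" using side by simp
  with Cons obtain M' where M': "maximum_matching E M'" "\<not> saturated M' b"
      "\<forall>e\<in>M. e \<inter> set (b # p) = {} \<longrightarrow> e \<in> M'"
      "\<forall>y. y \<notin> X \<longrightarrow> saturated M' y \<longrightarrow> saturated M y"
    by (metis alt_path.simps(3))
  have "{a, y} \<inter> set (b # p) = {}"
    using \<open>y \<notin> X\<close> side Cons.prems(1) by auto
  then have ay: "{a, y} \<in> M'" using M'(3) y(1) by blast
  let ?N = "insert {y, b} (M' - {{a, y}})"
  have "maximum_matching E ?N" "\<not> saturated ?N a"
    using maximum_matching_swap[OF M'(1,2) y(2) ay] by blast+
  moreover have "\<forall>e\<in>M. e \<inter> set (a # b # p) = {} \<longrightarrow> e \<in> ?N"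
    using M'(3) by auto
  moreover have "saturated M z" if "z \<notin> X" "saturated ?N z" for z
  proof -
    \<comment> \<open>\<open>y\<close> was already saturated through \<open>{a, y}\<close>, and the
      only newly saturated vertex \<open>b\<close> lies in \<open>X\<close>.\<close>
    have "saturated M' z" using that ay \<open>b \<in> X\<close> unfolding saturated_def by blast
    then show ?thesis using M'(4) that by blast
  qed
  ultimately show ?case by blast
qed

text \<open>An exchange frees \<open>a\<close>; were \<open>y\<close> free as well, adding
  \<open>{y, a}\<close> would enlarge a maximum matching. So \<open>y\<close> has a partner in
  \<open>M\<close>, and that partner reaches \<open>v\<close> through \<open>a\<close>.\<close>

lemma matched_neighbour:
  assumes M: "maximum_matching E M" and r: "(alt_step E M)\<^sup>*\<^sup>* a v" "\<not> saturated M v"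
    and "a \<in> X" and ay: "{y, a} \<in> E"
  obtains c where "{c, y} \<in> M" "(alt_step E M)\<^sup>*\<^sup>* c v"
proof -
  have sub: "M \<subseteq> E" using M by (simp add: maximum_matching_def matching_def)
  obtain p where "alt_path E M (a # p)" using alt_path_from_reachable r by blast
  then obtain M' where M': "maximum_matching E M'" "\<not> saturated M' a"
      "\<forall>y. y \<notin> X \<longrightarrow> saturated M' y \<longrightarrow> saturated M y"
    using exchange_along_path[OF M] \<open>a \<in> X\<close> by blast
  have "saturated M' y"
  proof (rule ccontr)
    assume y: "\<not> saturated M' y"
    then have "matching E (insert {y, a} M')"
      using M'(1,2) ay unfolding matching_def maximum_matching_def saturated_def by auto
    moreover have "card (insert {y, a} M') = Suc (card M')"
      using y unfolding saturated_def by (subst card_insert_disjoint) auto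
    ultimately show False using M'(1) unfolding maximum_matching_def
      by (metis Suc_n_not_le_n)
  qed
  moreover have "y \<notin> X" using crossing ay \<open>a \<in> X\<close> by blast
  ultimately have "saturated M y" using M'(3) by blast
  then obtain c where c: "{y, c} \<in> M" using saturatedE sub by blast
  then have "alt_step E M c a" using ay unfolding alt_step_def by (auto simp: insert_commute)
  then show thesis using that c r(1) by (metis converse_rtranclp_into_rtranclp insert_commute)
qed

section \<open>Sign alternation and closed walks\<close>

lemma cycle_from_closed_alternating_walk:
  assumes M: "matching E M" and l: "2 \<le> l" and "f l = f 0" and inj: "inj_on f {..<l}"
    and X: "\<And>k. k < l \<Longrightarrow> f k \<in> X"
    and fm: "\<And>k. k < l \<Longrightarrow> {f k, m k} \<in> M"
    and mf: "\<And>k. k < l \<Longrightarrow> {m k, f (Suc k)} \<in> E"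
  shows "\<exists>c. is_cycle E c \<and> length c = 2 * l"
proof -
  have sub: "M \<subseteq> E" using M by (simp add: matching_def)
  have mX: "m k \<notin> X" if "k < l" for k using crossing fm X sub that by blast
  have m_inj: "j = k" if "j < l" "k < l" "m j = m k" for j k
  proof -
    have "f j = f k" using matching_partner_unique[OF M] fm that by metis
    then show ?thesis using inj that by (simp add: inj_on_eq_iff)
  qed
  \<comment> \<open>The cycle interleaves the walk with the partners, so the parity of a position
    tells the side of its vertex.\<close>
  define h where "h k = (if even k then f (k div 2) else m (k div 2))" for k
  define c where "c = map h [0..<2 * l]"
  have len: "length c = 2 * l" by (simp add: c_def)
  have "inj_on h {0..<2 * l}"
  proof (rule inj_onI)
    fix j k assume "j \<in> {0..<2 * l}" "k \<in> {0..<2 * l}" and eq: "h j = h k"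
    then have b: "j div 2 < l" "k div 2 < l" by auto
    then have ev: "even j \<longleftrightarrow> even k"
      using eq X mX unfolding h_def by (metis (full_types))
    then have "j div 2 = k div 2"
      using eq b inj m_inj unfolding h_def
      by (auto simp: inj_on_eq_iff split: if_splits)
    then show "j = k" using ev by (metis bit_eq_rec)
  qed
  then have "distinct c" by (simp add: c_def distinct_map)
  moreover have "{c ! k, c ! (Suc k mod length c)} \<in> E" if "k < length c" for k
  proof -
    have k: "k < 2 * l" "k div 2 < l" using that len by auto
    show ?thesis
    proof (cases "even k")
      case True
      then have "Suc k < 2 * l" using k(1) by presburger
      then have "c ! k = f (k div 2)" "c ! (Suc k mod length c) = m (k div 2)"
        using True k len by (auto simp: c_def h_def)
      then show ?thesis using fm[OF k(2)] sub by auto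
    next
      case False
      have "c ! k = m (k div 2)" using False k by (simp add: c_def h_def)
      moreover have "c ! (Suc k mod length c) = f (Suc (k div 2))"
      \<comment> \<open>At the last position the index wraps to 0, where \<open>f 0 = f l\<close>
        closes the cycle.\<close>
      proof (cases "Suc k = 2 * l")
        case True
        then have "Suc (k div 2) = l" by presburger
        then show ?thesis using True len l \<open>f l = f 0\<close> by (simp add: c_def h_def)
      next
        case neq: False
        then have "Suc k < 2 * l" using k by simp
        moreover have "Suc k div 2 = Suc (k div 2)" using False by presburger
        ultimately show ?thesis using False len by (simp add: c_def h_def)
      qed
      ultimately show ?thesis using mf[OF k(2)] by simp
    qed
  qed
  moreover have "3 \<le> length c" using len l by simp
  ultimately show ?thesis unfolding is_cycle_def using len by blast
qed

text \<open>Otherwise the equation at \<open>y\<close>, multiplied by \<open>x $ a\<close>, has only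
  nonnegative terms, and the one at \<open>a\<close> is a positive square.\<close>

lemma opposite_sign_neighbour:
  assumes "x \<in> Null E" "{a, y} \<in> E" "x $ a \<noteq> 0"
  shows "\<exists>b. {y, b} \<in> E \<and> x $ a * x $ b < 0"
proof (rule ccontr)
  assume neg: "\<not> ?thesis"
  have "(\<Sum>w | {y, w} \<in> E. x $ a * x $ w) > 0"
  proof (rule sum_pos2[where i = a])
    show "a \<in> {w. {y, w} \<in> E}" using assms by (simp add: insert_commute)
    show "0 < x $ a * x $ a" using assms not_real_square_gt_zero by blast
    show "0 \<le> x $ a * x $ w" if "w \<in> {w. {y, w} \<in> E}" for w
      using neg that by force
  qed simp
  moreover have "(\<Sum>w | {y, w} \<in> E. x $ a * x $ w) = x $ a * (\<Sum>w | {y, w} \<in> E. x $ w)"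
    by (simp add: sum_distrib_left)
  ultimately show False using assms(1) by (simp add: Null_iff)
qed

text \<open>Otherwise a choice of opposite-sign successors can be iterated forever inside a finite
  set. That \<open>x\<close> is nonzero at \<open>b\<close> is recorded because it later identifies
  \<open>b\<close> with \<open>v\<close>.\<close>

lemma reach_unsaturated:
  assumes free: "\<not> (\<exists>c. is_cycle E c \<and> 4 dvd length c)"
    and M: "matching E M" and x: "x \<in> Null E" "x $ a \<noteq> 0" and "a \<in> X"
  shows "\<exists>b. (alt_step E M)\<^sup>*\<^sup>* a b \<and> x $ b \<noteq> 0 \<and> \<not> saturated M b"
proof (rule ccontr)
  assume none: "\<not> ?thesis"
  define S where "S = {b. (alt_step E M)\<^sup>*\<^sup>* a b \<and> x $ b \<noteq> 0}"
  have sat: "saturated M b" if "b \<in> S" for b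
    using none that unfolding S_def by blast
  have sub: "M \<subseteq> E" using M by (simp add: matching_def)
  have SX: "S \<subseteq> X" using reachable_side sub \<open>a \<in> X\<close> unfolding S_def by blast
  have "\<exists>y b'. {b, y} \<in> M \<and> {y, b'} \<in> E \<and> x $ b * x $ b' < 0 \<and> b' \<in> S" if b: "b \<in> S" for b
  proof -
    obtain y where y: "{b, y} \<in> M" using saturatedE[OF sub sat[OF b]] .
    then obtain b' where b': "{y, b'} \<in> E" "x $ b * x $ b' < 0"
      using opposite_sign_neighbour x(1) b sub unfolding S_def by blast
    then have "alt_step E M b b'" "x $ b' \<noteq> 0" using y unfolding alt_step_def by auto
    then have "b' \<in> S" using b unfolding S_def by auto
    then show ?thesis using y b' by blast
  qed
  then obtain m g where
    mg: "\<And>b. b \<in> S \<Longrightarrow> {b, m b} \<in> M \<and> {m b, g b} \<in> E \<and> x $ b * x $ g b < 0 \<and> g b \<in> S"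
    by metis
  define f where "f n = (g ^^ n) a" for n
  have fS: "f n \<in> S" for n
    by (induction n) (use mg x(2) in \<open>auto simp: f_def S_def\<close>)
  have f_Suc: "f (Suc n) = g (f n)" for n by (simp add: f_def)
  have square_pos: "x $ f i * x $ f i > 0" for i
    using fS not_real_square_gt_zero unfolding S_def by blast
  have sign: "x $ f i * x $ f (i + n) > 0 \<longleftrightarrow> even n" for i n
  proof (induction n)
    case 0
    show ?case using square_pos by simp
  next
    case (Suc n)
    have "x $ f (i + n) * x $ f (i + Suc n) < 0" using mg fS f_Suc by simp
    moreover have "x $ f i \<noteq> 0" using fS S_def by blast
    ultimately show ?case using Suc
      by (auto simp: zero_less_mult_iff mult_less_0_iff)
  qed
  have "\<not> inj f" using finite_imageD[of f UNIV] by auto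
  then obtain i j where "i < j" "f i = f j"
    unfolding inj_def by (metis linorder_neqE_nat)
  then have ex: "\<exists>l>0. \<exists>i. f (i + l) = f i"
    by (intro exI[of _ "j - i"]) (auto intro!: exI[of _ i])
  \<comment> \<open>Minimality is over all starting indices at once, so any \<open>l\<close>
    consecutive terms of \<open>f\<close> are distinct.\<close>
  define l where "l = (LEAST l. 0 < l \<and> (\<exists>i. f (i + l) = f i))"
  have "l > 0" and "\<exists>i. f (i + l) = f i"
    using LeastI_ex[OF ex] unfolding l_def by blast+
  have least: "f (i + l') \<noteq> f i" if "0 < l'" "l' < l" for l' i
    using not_less_Least that unfolding l_def by blast
  obtain i where i: "f (i + l) = f i"
    using \<open>\<exists>i. f (i + l) = f i\<close> by blast
  \<comment> \<open>At a return the product in \<open>sign\<close> is a square, hence positive.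
    Evenness excludes \<open>l = 1\<close>, which would give no cycle, and makes
    \<open>2 * l\<close> a multiple of 4.\<close>
  have "even l" using sign[of i l] i square_pos by simp
  have "inj_on (\<lambda>k. f (i + k)) {..<l}"
  proof (rule linorder_inj_onI)
    fix p q assume "p < q" "p \<in> {..<l}" "q \<in> {..<l}"
    then have "f ((i + p) + (q - p)) \<noteq> f (i + p)"
      by (intro least) auto
    then show "f (i + p) \<noteq> f (i + q)" using \<open>p < q\<close> by auto
  qed auto
  then have "\<exists>c. is_cycle E c \<and> length c = 2 * l"
  proof (rule cycle_from_closed_alternating_walk[OF M, rotated 2])
    show "2 \<le> l" using \<open>l > 0\<close> \<open>even l\<close> by (simp add: dvd_imp_le)
    show "f (i + l) = f (i + 0)" using i by simp
    show "f (i + k) \<in> X" for k using fS SX by blast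
    show "{f (i + k), m (f (i + k))} \<in> M" for k using fS mg by blast
    show "{m (f (i + k)), f (i + Suc k)} \<in> E" for k using fS mg f_Suc by simp
  qed
  then show False using free \<open>even l\<close> by auto
qed

section \<open>The two implications\<close>

lemma unsaturated_in_Supp:
  assumes free: "\<not> (\<exists>c. is_cycle E c \<and> 4 dvd length c)"
    and M: "maximum_matching E M" and v: "\<not> saturated M v" "v \<in> X"
  shows "v \<in> Supp E"
proof -
  have mat: "matching E M" using M by (simp add: maximum_matching_def)
  then have sub: "M \<subseteq> E" by (simp add: matching_def)
  define R where "R = {a \<in> X. (alt_step E M)\<^sup>*\<^sup>* a v}"
  \<comment> \<open>Reaching \<open>v\<close> from another vertex takes a first double step, which
    begins with an edge of \<open>M\<close>.\<close>
  have R_sat: "saturated M c" if "c \<in> R" "c \<noteq> v" for c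
  proof -
    have "(alt_step E M)\<^sup>*\<^sup>* c v" using that(1) by (simp add: R_def)
    then obtain d where "alt_step E M c d"
      using \<open>c \<noteq> v\<close> by (cases rule: converse_rtranclpE) blast+
    then show ?thesis unfolding alt_step_def saturated_def by blast
  qed
  have "\<forall>c\<in>R - {v}. \<exists>y. {c, y} \<in> M"
    using R_sat saturatedE[OF sub] by (metis DiffE singletonI)
  then obtain m where m: "\<And>c. c \<in> R - {v} \<Longrightarrow> {c, m c} \<in> M" by metis
  \<comment> \<open>The linear system is made square: coordinates outside \<open>R\<close> force
    \<open>x\<close> to vanish there, those in \<open>R - {v}\<close> are the equations at the
    partners, and the constant 0 at \<open>v\<close> destroys surjectivity, hence
    injectivity.\<close>
  define F :: "real ^ 'v \<Rightarrow> real ^ 'v" where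
    "F x = (\<chi> c. if c = v then 0 else if c \<in> R then \<Sum>w | {m c, w} \<in> E. x $ w else x $ c)" for x
  have "linear F"
    by (rule linearI) (auto simp: F_def vec_eq_iff sum.distrib sum_distrib_left)
  moreover have "\<not> surj F"
  proof
    assume "surj F"
    then obtain x where "F x = axis v 1" by (metis surjD)
    then have "F x $ v = 1" by simp
    then show False by (simp add: F_def)
  qed
  ultimately obtain x where x: "F x = 0" "x \<noteq> 0"
    using linear_injective_imp_surjective linear_injective_0 by blast
  have Fx: "F x $ c = 0" for c using x by simp
  have "v \<in> R" using v by (simp add: R_def)
  then have out: "x $ c = 0" if "c \<notin> R" for c
    using Fx[of c] that by (auto simp: F_def split: if_splits)
  have null: "x \<in> Null E"
    unfolding Null_iff
  proof
    fix y
    show "(\<Sum>w | {y, w} \<in> E. x $ w) = 0"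
    proof (cases "\<exists>a\<in>R. {y, a} \<in> E")
      case True
      then obtain a where a: "a \<in> R" "{y, a} \<in> E" by blast
      \<comment> \<open>Maximality provides a partner \<open>c\<close> of \<open>y\<close> in
        \<open>R - {v}\<close>, so the equation at \<open>y\<close> is the coordinate of
        \<open>F x\<close> at \<open>c\<close>.\<close>
      then obtain c where c: "{c, y} \<in> M" "(alt_step E M)\<^sup>*\<^sup>* c v"
        using matched_neighbour[OF M _ v(1)] unfolding R_def by blast
      have "c \<noteq> v" using c(1) v(1) unfolding saturated_def by blast
      moreover have "c \<in> X" using crossing a c(1) sub unfolding R_def by blast
      ultimately have "c \<in> R - {v}" using c(2) unfolding R_def by simp
      moreover from this have "m c = y"
        using matching_partner_unique[OF mat] m c(1) by (metis insert_commute)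
      ultimately show ?thesis using Fx[of c] by (simp add: F_def)
    next
      case False
      then show ?thesis using out by (intro sum.neutral) auto
    qed
  qed
  obtain a where "x $ a \<noteq> 0" using x(2) by (auto simp: vec_eq_iff)
  moreover from this have "a \<in> X" using out unfolding R_def by blast
  ultimately obtain b where "x $ b \<noteq> 0" "\<not> saturated M b"
    using reach_unsaturated[OF free mat null] by blast
  then have "b = v" using R_sat out by blast
  then show ?thesis using \<open>x $ b \<noteq> 0\<close> null unfolding Supp_def by blast
qed

lemma Supp_unsaturated:
  assumes free: "\<not> (\<exists>c. is_cycle E c \<and> 4 dvd length c)"
    and "v \<in> X" "v \<in> Supp E"
  shows "\<exists>M. maximum_matching E M \<and> \<not> saturated M v"
proof -
  obtain M where M: "maximum_matching E M" using maximum_matching_exists by blast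
  then have mat: "matching E M" by (simp add: maximum_matching_def)
  obtain x where "x \<in> Null E" "x $ v \<noteq> 0" using assms unfolding Supp_def by blast
  then obtain b where "(alt_step E M)\<^sup>*\<^sup>* v b" "\<not> saturated M b"
    using reach_unsaturated[OF free mat] \<open>v \<in> X\<close> by blast
  then obtain p where "alt_path E M (v # p)" using alt_path_from_reachable by blast
  then show ?thesis using exchange_along_path[OF M] \<open>v \<in> X\<close> by blast
qed

end

theorem theorem2p11:
  fixes E :: "'v::finite set set" and v :: 'v
  assumes "C4k_free_bipartite E"
  shows "v \<in> Supp E \<longleftrightarrow> (\<exists>M. maximum_matching E M \<and> \<not> saturated M v)"
proof -
  have free: "\<not> (\<exists>c. is_cycle E c \<and> 4 dvd length c)" and "simple_graph E"
    using assms by (simp_all add: C4k_free_bipartite_def)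
  obtain X Y where XY: "X \<union> Y = UNIV" "X \<inter> Y = {}" "\<forall>e\<in>E. \<exists>x\<in>X. \<exists>y\<in>Y. e = {x, y}"
    using assms unfolding C4k_free_bipartite_def bipartite_def by blast
  have cross: "u \<in> X \<longleftrightarrow> w \<notin> X" if uw: "{u, w} \<in> E" for u w
  proof -
    obtain x y where "x \<in> X" "y \<in> Y" "{u, w} = {x, y}" using XY(3) uw by blast
    then show ?thesis using XY(2) by (auto simp: doubleton_eq_iff)
  qed
  \<comment> \<open>Both implications were shown for \<open>v\<close> on the fixed side; the
    complement of \<open>X\<close> satisfies \<open>crossing\<close> too.\<close>
  define Z where "Z = (if v \<in> X then X else - X)"
  interpret bipartite_graph E Z
    by unfold_locales (use \<open>simple_graph E\<close> cross in \<open>auto simp: Z_def\<close>)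
  have "v \<in> Z" by (simp add: Z_def)
  then show ?thesis using Supp_unsaturated unsaturated_in_Supp free by blast
qed

end
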